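(* Let $S$ be a finite subset of $]0,+\infty[$. Then every element of $\mathcal{U}_S$ has a big Ramsey degree in $\mathcal{U}_S$.
   Context: $\mathcal{U}_S$ is the class of all (nonempty) finite ultrametric spaces whose distances between distinct points all belong to $S$ (ultrametric: $d(x,z)\leqslant\max(d(x,y),d(y,z))$). $\mathbf{B}_S$ is the space of all finitely supported elements of $\mathbb{Q}^S$ with distance $d(x,y)=\max\{s\in S:x(s)\neq y(s)\}$ for $x\neq y$; it is the countable ultrahomogeneous metric space (Fra\"iss\'e limit, or Urysohn space) associated to $\mathcal{U}_S$. For metric spaces $X,Z$, $\binom{Z}{X}$ denotes the set of all subspaces of $Z$ isometric to $X$. An element $X\in\mathcal{U}_S$ has a big Ramsey degree in $\mathcal{U}_S$ when there is an integer $l\geqslant1$ such that for every integer $k\geqslant1$ and every $\chi:\binom{\mathbf{B}_S}{X}\to\{0,\dots,k-1\}$ there is $B\in\binom{\mathbf{B}_S}{\mathbf{B}_S}$ such that $\chi$ takes at most $l$ values on $\binom{B}{X}$. *)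

theory Defs
  imports "HOL-Analysis.Abstract_Metric_Spaces"
begin

definition ultrametric_class :: "real set \<Rightarrow> 'a metric set" where
  "ultrametric_class S = {X. finite (mspace X) \<and> mspace X \<noteq> {} \<and>
     (\<forall>x\<in>mspace X. \<forall>y\<in>mspace X. \<forall>z\<in>mspace X. mdist X x z \<le> max (mdist X x y) (mdist X y z)) \<and>
     (\<forall>x\<in>mspace X. \<forall>y\<in>mspace X. x \<noteq> y \<longrightarrow> mdist X x y \<in> S)}"

definition urysohn_points :: "real set \<Rightarrow> (real \<Rightarrow> rat) set" where
  "urysohn_points S = {x \<in> S \<rightarrow>\<^sub>E UNIV. finite {s\<in>S. x s \<noteq> 0}}"

(* The value 0 outside urysohn_points is only there because Metric_space demands a
   nonnegative, symmetric distance function on the whole type. *)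
definition urysohn_dist :: "real set \<Rightarrow> (real \<Rightarrow> rat) \<Rightarrow> (real \<Rightarrow> rat) \<Rightarrow> real" where
  "urysohn_dist S x y =
     (if x \<in> urysohn_points S \<and> y \<in> urysohn_points S \<and> x \<noteq> y
      then Max {s\<in>S. x s \<noteq> y s} else 0)"

(* Meaningful for S \<subseteq> {0<..}: see mspace_urysohn_metric and mdist_urysohn_metric. *)
definition urysohn_metric :: "real set \<Rightarrow> (real \<Rightarrow> rat) metric" where
  "urysohn_metric S = metric (urysohn_points S, urysohn_dist S)"

definition isometric :: "'a metric \<Rightarrow> 'b metric \<Rightarrow> bool" where
  "isometric X Y \<longleftrightarrow> (\<exists>f. bij_betw f (mspace X) (mspace Y) \<and>
     (\<forall>x\<in>mspace X. \<forall>y\<in>mspace X. mdist Y (f x) (f y) = mdist X x y))"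

definition copies :: "'a metric \<Rightarrow> 'b metric \<Rightarrow> 'a metric set" where
  "copies Z X = {submetric Z A | A. A \<subseteq> mspace Z \<and> isometric X (submetric Z A)}"

(* Each colouring has finite range {..<k}, so card really counts the values taken. *)
definition has_big_ramsey_degree :: "real set \<Rightarrow> 'a metric \<Rightarrow> bool" where
  "has_big_ramsey_degree S X \<longleftrightarrow>
     (\<exists>l::nat. l \<ge> 1 \<and>
       (\<forall>k::nat. k \<ge> 1 \<longrightarrow>
         (\<forall>c. c \<in> copies (urysohn_metric S) X \<rightarrow> {..<k} \<longrightarrow>
           (\<exists>B \<in> copies (urysohn_metric S) (urysohn_metric S).
              card (c ` copies B X) \<le> l))))"

lemma urysohn_diff_set:
  assumes "x \<in> urysohn_points S" "y \<in> urysohn_points S" "x \<noteq> y"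
  shows "finite {s\<in>S. x s \<noteq> y s}" "{s\<in>S. x s \<noteq> y s} \<noteq> {}"
proof -
  have "{s\<in>S. x s \<noteq> y s} \<subseteq> {s\<in>S. x s \<noteq> 0} \<union> {s\<in>S. y s \<noteq> 0}"
    by auto
  then show "finite {s\<in>S. x s \<noteq> y s}"
    using assms by (auto simp: urysohn_points_def intro: finite_subset)
  show "{s\<in>S. x s \<noteq> y s} \<noteq> {}"
  proof
    assume "{s\<in>S. x s \<noteq> y s} = {}"
    then have "x = y"
      using assms by (intro PiE_ext[of x S _ y]) (auto simp: urysohn_points_def)
    with assms show False by simp
  qed
qed

lemma urysohn_dist_in:
  assumes "x \<in> urysohn_points S" "y \<in> urysohn_points S" "x \<noteq> y"
  shows "urysohn_dist S x y \<in> S"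
  using Max_in[OF urysohn_diff_set[OF assms]] assms by (simp add: urysohn_dist_def)

lemma urysohn_dist_nonneg:
  assumes "S \<subseteq> {0<..}"
  shows "0 \<le> urysohn_dist S x y"
proof (cases "x \<in> urysohn_points S \<and> y \<in> urysohn_points S \<and> x \<noteq> y")
  case True
  then show ?thesis using urysohn_dist_in[of x S y] assms by force
qed (auto simp: urysohn_dist_def)

lemma urysohn_dist_ultra:
  assumes "S \<subseteq> {0<..}"
    and "x \<in> urysohn_points S" "y \<in> urysohn_points S" "z \<in> urysohn_points S"
  shows "urysohn_dist S x z \<le> max (urysohn_dist S x y) (urysohn_dist S y z)"
proof (cases "x = z")
  case True
  then show ?thesis
    using urysohn_dist_nonneg[OF assms(1), of x y] by (simp add: urysohn_dist_def)
next
  case False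
  define m where "m = Max {s\<in>S. x s \<noteq> z s}"
  have le: "m \<le> urysohn_dist S u v"
    if "u \<in> urysohn_points S" "v \<in> urysohn_points S" "m \<in> S" "u m \<noteq> v m" for u v
  proof -
    have "u \<noteq> v" using that by auto
    then show ?thesis
      using that urysohn_diff_set[of u S v] by (auto simp: urysohn_dist_def intro!: Max_ge)
  qed
  have m: "m \<in> S" "x m \<noteq> z m"
    using Max_in[OF urysohn_diff_set[OF assms(2,4) False]] by (auto simp: m_def)
  then have "x m \<noteq> y m \<or> y m \<noteq> z m" by auto
  then have "m \<le> max (urysohn_dist S x y) (urysohn_dist S y z)"
    using le[of x y] le[of y z] m assms by (metis max.coboundedI1 max.coboundedI2)
  then show ?thesis using False assms by (simp add: urysohn_dist_def m_def)
qed

lemma Metric_space_urysohn: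
  assumes "S \<subseteq> {0<..}"
  shows "Metric_space (urysohn_points S) (urysohn_dist S)"
proof
  show "0 \<le> urysohn_dist S x y" for x y
    by (rule urysohn_dist_nonneg[OF assms])
  show "urysohn_dist S x y = urysohn_dist S y x" for x y
  proof -
    have "{s\<in>S. x s \<noteq> y s} = {s\<in>S. y s \<noteq> x s}" by auto
    then show ?thesis unfolding urysohn_dist_def by metis
  qed
  show "urysohn_dist S x y = 0 \<longleftrightarrow> x = y"
    if "x \<in> urysohn_points S" "y \<in> urysohn_points S" for x y
    using urysohn_dist_in[OF that] assms by (cases "x = y") (force simp: urysohn_dist_def)+
  show "urysohn_dist S x z \<le> urysohn_dist S x y + urysohn_dist S y z"
    if "x \<in> urysohn_points S" "y \<in> urysohn_points S" "z \<in> urysohn_points S" for x y z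
    using urysohn_dist_ultra[OF assms that] urysohn_dist_nonneg[OF assms, of x y]
      urysohn_dist_nonneg[OF assms, of y z] by linarith
qed

lemma mspace_urysohn_metric:
  assumes "S \<subseteq> {0<..}"
  shows "mspace (urysohn_metric S) = urysohn_points S"
  unfolding urysohn_metric_def
  by (simp add: Metric_space.mspace_metric[OF Metric_space_urysohn[OF assms]])

lemma mdist_urysohn_metric:
  assumes "S \<subseteq> {0<..}" "x \<in> urysohn_points S" "y \<in> urysohn_points S"
  shows "mdist (urysohn_metric S) x y = (if x = y then 0 else Max {s\<in>S. x s \<noteq> y s})"
  unfolding urysohn_metric_def
  using assms
  by (simp add: Metric_space.mdist_metric[OF Metric_space_urysohn[OF assms(1)]] urysohn_dist_def)

end

theory Submission
  imports Defs "HOL-Library.Ramsey"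
begin

text \<open>
  The points of the Urysohn space are the functions from the finite set \<open>S\<close> to the rationals. The
  distance of two points depends only on the set of coordinates in which they differ, so applying
  one injection of the rationals into an infinite set \<open>W\<close> to all coordinates is an isometry
  (\<open>isometric_coordinatewise_image\<close>). Hence every infinite set \<open>W\<close> of rationals yields a copy of
  the whole space inside the cube of functions \<open>S \<rightarrow>\<^sub>E W\<close>.

  A set of at most \<open>m\<close> points of this cube uses at most \<open>r = m * card S\<close> rationals. Choose a set
  \<open>U\<close> of exactly \<open>r\<close> elements of \<open>W\<close> containing them. The set of points is then described by \<open>U\<close>
  and by a pattern, namely a set of functions from \<open>S\<close> to \<open>{..<r}\<close> that tells which position of
  the increasing enumeration of \<open>U\<close> stands in which coordinate
  (\<open>small_set_has_pattern\<close>). The number of patterns depends only on \<open>m\<close> and \<open>S\<close>.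

  A finite colouring of the copies of \<open>X\<close>, where \<open>X\<close> has \<open>m\<close> points, induces a finite colouring of
  the \<open>r\<close>-element sets \<open>U\<close> of rationals: colour \<open>U\<close> by the function that maps each pattern to the
  colour of the set of points it describes over \<open>U\<close>. By the infinite Ramsey theorem this colouring
  is constant on the \<open>r\<close>-element subsets of some infinite \<open>W\<close>, so that inside the copy of the
  space given by \<open>W\<close> the colour of a copy of \<open>X\<close> depends only on its pattern. The number of
  patterns therefore bounds the number of colours, whatever the colouring.
\<close>

lemma Ramsey_finite_colours:
  fixes f :: "'a set \<Rightarrow> 'c"
  assumes "infinite Z" "finite C"
    and f: "\<And>U. U \<subseteq> Z \<Longrightarrow> finite U \<Longrightarrow> card U = r \<Longrightarrow> f U \<in> C"
  obtains W c where "W \<subseteq> Z" "infinite W"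
    "\<And>U. U \<subseteq> W \<Longrightarrow> finite U \<Longrightarrow> card U = r \<Longrightarrow> f U = c"
proof -
  obtain g where g: "bij_betw g C {0..<card C}"
    using ex_bij_betw_finite_nat[OF \<open>finite C\<close>] by blast
  have "g (f U) < card C" if "U \<subseteq> Z" "finite U" "card U = r" for U
    using bij_betwE[OF g] f[OF that] by auto
  then have "\<forall>U. U \<subseteq> Z \<and> finite U \<and> card U = r \<longrightarrow> g (f U) < card C"
    by blast
  from Ramsey[OF \<open>infinite Z\<close> this] obtain W t where W: "W \<subseteq> Z" "infinite W"
    and t: "\<forall>U. U \<subseteq> W \<and> finite U \<and> card U = r \<longrightarrow> g (f U) = t"
    by blast
  have "f U = inv_into C g t" if "U \<subseteq> W" "finite U" "card U = r" for U
  proof -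
    have "f U \<in> C"
      using f that W by blast
    moreover have "g (f U) = t"
      using t that by blast
    ultimately show ?thesis
      using bij_betw_inv_into_left[OF g, of "f U"] by simp
  qed
  then show thesis
    by (rule that[OF W])
qed

definition point_at :: "'i set \<Rightarrow> 'a::linorder set \<Rightarrow> ('i \<Rightarrow> nat) \<Rightarrow> 'i \<Rightarrow> 'a" where
  "point_at S U p = (\<lambda>s\<in>S. sorted_list_of_set U ! p s)"

text \<open>
  Padding the set of occurring entries to a fixed size \<open>m * card S\<close> makes a single exponent
  suffice when the infinite Ramsey theorem is applied to the sets \<open>U\<close>.
\<close>

lemma small_set_has_pattern:
  fixes W :: "'a::linorder set"
  assumes "finite S" "infinite W" and A: "A \<subseteq> S \<rightarrow>\<^sub>E W" "finite A" "card A \<le> m"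
  obtains U P where "U \<subseteq> W" "finite U" "card U = m * card S"
    "P \<subseteq> S \<rightarrow>\<^sub>E {..<m * card S}" "A = point_at S U ` P"
proof -
  define V where "V = (\<lambda>(x, s). x s) ` (A \<times> S)"
  have V: "finite V" "V \<subseteq> W"
    using A \<open>finite S\<close> by (auto simp: V_def)
  have "card V \<le> card (A \<times> S)"
    unfolding V_def using A \<open>finite S\<close> by (intro card_image_le) auto
  also have "\<dots> \<le> m * card S"
    using A by (simp add: card_cartesian_product)
  finally have card_V: "card V \<le> m * card S" .
  have "infinite (W - V)"
    using V \<open>infinite W\<close> by simp
  then obtain T where T: "T \<subseteq> W - V" "finite T" "card T = m * card S - card V"
    by (meson infinite_arbitrarily_large)
  define U where "U = V \<union> T"
  have U: "U \<subseteq> W" "finite U" "card U = m * card S"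
    using T V card_V card_Un_disjoint[of V T] by (auto simp: U_def)
  define P where "P = {p \<in> S \<rightarrow>\<^sub>E {..<m * card S}. point_at S U p \<in> A}"
  have "x \<in> point_at S U ` P" if "x \<in> A" for x
  proof -
    have "\<exists>i<m * card S. sorted_list_of_set U ! i = x s" if "s \<in> S" for s
    proof -
      have "x s \<in> set (sorted_list_of_set U)"
        using U \<open>x \<in> A\<close> that by (auto simp: U_def V_def)
      then show ?thesis
        using U by (metis in_set_conv_nth length_sorted_list_of_set)
    qed
    then obtain i where i: "\<And>s. s \<in> S \<Longrightarrow> i s < m * card S \<and> sorted_list_of_set U ! i s = x s"
      by metis
    have "x s = undefined" if "s \<notin> S" for s
      using A \<open>x \<in> A\<close> that by (blast intro: PiE_arb)
    then have "x = point_at S U (restrict i S)"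
      using i by (intro ext) (simp add: point_at_def)
    moreover have "restrict i S \<in> S \<rightarrow>\<^sub>E {..<m * card S}"
      using i by (simp add: restrict_PiE_iff)
    ultimately show ?thesis
      using \<open>x \<in> A\<close> unfolding P_def by blast
  qed
  then have "A = point_at S U ` P"
    by (auto simp: P_def)
  moreover have "P \<subseteq> S \<rightarrow>\<^sub>E {..<m * card S}"
    unfolding P_def by (rule Collect_restrict)
  ultimately show thesis
    using that[OF U] by blast
qed

lemma urysohn_points_finite:
  assumes "finite S"
  shows "urysohn_points S = S \<rightarrow>\<^sub>E UNIV"
  using assms by (auto simp: urysohn_points_def)

lemma isometric_coordinatewise_image:
  fixes h :: "rat \<Rightarrow> rat"
  assumes "finite S" "S \<subseteq> {0<..}" "inj h"
  defines "\<phi> \<equiv> \<lambda>x. \<lambda>s\<in>S. h (x s)"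
  shows "isometric (urysohn_metric S)
    (submetric (urysohn_metric S) (\<phi> ` urysohn_points S))"
proof -
  let ?M = "urysohn_metric S" and ?E = "urysohn_points S"
  have space: "mspace ?M = ?E"
    using assms by (simp add: mspace_urysohn_metric)
  have into: "\<phi> x \<in> ?E" for x
    using assms by (simp add: urysohn_points_finite \<phi>_def)
  have diff: "{s\<in>S. \<phi> x s \<noteq> \<phi> y s} = {s\<in>S. x s \<noteq> y s}" for x y
    using \<open>inj h\<close> by (auto simp: \<phi>_def inj_eq)
  have inj: "\<phi> x = \<phi> y \<longleftrightarrow> x = y" if "x \<in> ?E" "y \<in> ?E" for x y
  proof
    assume "\<phi> x = \<phi> y"
    then have "{s\<in>S. x s \<noteq> y s} = {}"
      using diff[of x y] by simp
    then show "x = y"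
      using urysohn_diff_set(2)[OF that] by blast
  qed simp
  have "mdist ?M (\<phi> x) (\<phi> y) = mdist ?M x y" if "x \<in> ?E" "y \<in> ?E" for x y
    using that assms(2) by (simp add: mdist_urysohn_metric into inj diff)
  moreover have "bij_betw \<phi> ?E (\<phi> ` ?E)"
    by (auto intro!: bij_betw_imageI inj_onI simp: inj)
  moreover have "\<phi> ` ?E \<inter> ?E = \<phi> ` ?E" "?E \<inter> \<phi> ` ?E = \<phi> ` ?E"
    using into by auto
  ultimately show ?thesis
    unfolding isometric_def by (intro exI[of _ \<phi>]) (simp add: space)
qed

lemma copies_submetricE:
  assumes "Y \<in> copies (submetric M E) X"
  obtains A where "A \<subseteq> E" "A \<subseteq> mspace M" "Y = submetric M A" "isometric X (submetric M A)"
proof -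
  obtain A where A: "A \<subseteq> E \<inter> mspace M" "Y = submetric M (E \<inter> A)"
    "isometric X (submetric M (E \<inter> A))"
    using assms by (auto simp: copies_def)
  then have "E \<inter> A = A"
    by blast
  with A show thesis
    by (intro that[of A]) auto
qed

theorem theorem50:
  fixes S :: "real set"
  assumes "finite S" and "S \<subseteq> {0<..}"
  shows "\<forall>X \<in> (ultrametric_class S :: 'a metric set). has_big_ramsey_degree S X"
proof
  fix X :: "'a metric"
  assume "X \<in> ultrametric_class S"
  then have fin_X: "finite (mspace X)"
    by (simp add: ultrametric_class_def)
  let ?M = "urysohn_metric S" and ?E = "urysohn_points S"
  have space: "mspace ?M = ?E"
    using assms by (simp add: mspace_urysohn_metric)
  define m where "m = card (mspace X)"
  define r where "r = m * card S"
  define patterns where "patterns = Pow (S \<rightarrow>\<^sub>E {..<r})"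
  have fin_patterns: "finite patterns"
    using \<open>finite S\<close> by (simp add: patterns_def finite_PiE)
  have "patterns \<noteq> {}"
    by (auto simp: patterns_def)
  then have "card patterns \<ge> 1"
    using fin_patterns by (simp add: Suc_le_eq card_gt_0_iff)
  moreover have "\<exists>B \<in> copies ?M ?M. card (c ` copies B X) \<le> card patterns"
    if "k \<ge> 1" and c: "c \<in> copies ?M X \<rightarrow> {..<k}" for k :: nat and c
  proof -
    define set_at where "set_at U P = submetric ?M (point_at S U ` P)" for U P
    \<comment> \<open>The value \<open>0\<close> is a dummy colour for the patterns that do not describe a copy of \<open>X\<close>.\<close>
    define f where "f U = (\<lambda>P\<in>patterns. if set_at U P \<in> copies ?M X then c (set_at U P) else 0)"
      for U
    have f: "f U \<in> patterns \<rightarrow>\<^sub>E {..<k}" for U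
      using c \<open>k \<ge> 1\<close> by (auto simp: f_def Pi_iff)
    have "finite (patterns \<rightarrow>\<^sub>E {..<k})"
      using fin_patterns by (simp add: finite_PiE)
    moreover have "infinite (UNIV :: rat set)"
      by (rule infinite_UNIV_char_0)
    ultimately obtain W d where W: "infinite W"
      and d: "\<And>U. U \<subseteq> W \<Longrightarrow> finite U \<Longrightarrow> card U = r \<Longrightarrow> f U = d"
      using f Ramsey_finite_colours[of "UNIV :: rat set" "patterns \<rightarrow>\<^sub>E {..<k}" r f] by metis
    obtain e :: "nat \<Rightarrow> rat" where e: "inj e" "range e \<subseteq> W"
      using infinite_countable_subset[OF W] by blast
    define h :: "rat \<Rightarrow> rat" where "h = e \<circ> to_nat"
    have h: "inj h" "range h \<subseteq> W"
      using e by (auto simp: h_def intro: inj_compose)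
    define F where "F = (\<lambda>x. \<lambda>s\<in>S. h (x s)) ` ?E"
    have F: "F \<subseteq> S \<rightarrow>\<^sub>E W" "F \<subseteq> ?E"
      using h assms by (auto simp: F_def urysohn_points_finite)
    have "isometric ?M (submetric ?M F)"
      unfolding F_def using assms h by (intro isometric_coordinatewise_image)
    then have "submetric ?M F \<in> copies ?M ?M"
      using F by (auto simp: copies_def space)
    moreover have "c ` copies (submetric ?M F) X \<subseteq> d ` patterns"
    proof (rule image_subsetI)
      fix Y assume "Y \<in> copies (submetric ?M F) X"
      then obtain A where A: "A \<subseteq> F" "A \<subseteq> ?E" "Y = submetric ?M A"
        "isometric X (submetric ?M A)"
        unfolding space[symmetric] by (rule copies_submetricE)
      then have "mspace (submetric ?M A) = A"
        by (auto simp: space)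
      with A obtain g where "bij_betw g (mspace X) A"
        by (auto simp: isometric_def)
      then have "finite A" "card A \<le> m"
        using fin_X by (auto simp: m_def bij_betw_finite bij_betw_same_card)
      moreover have "A \<subseteq> S \<rightarrow>\<^sub>E W"
        using A F by blast
      ultimately obtain U P where U: "U \<subseteq> W" "finite U" "card U = r"
        and P: "P \<subseteq> S \<rightarrow>\<^sub>E {..<r}" "A = point_at S U ` P"
        unfolding r_def using small_set_has_pattern[OF \<open>finite S\<close> W] by metis
      have "P \<in> patterns" "Y = set_at U P"
        using P A by (auto simp: patterns_def set_at_def)
      moreover have "Y \<in> copies ?M X"
        using A by (auto simp: copies_def space)
      ultimately have "c Y = f U P"
        by (simp add: f_def)
      then show "c Y \<in> d ` patterns"
        using d[OF U] \<open>P \<in> patterns\<close> by simp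
    qed
    then have "card (c ` copies (submetric ?M F) X) \<le> card patterns"
      using fin_patterns by (meson surj_card_le)
    ultimately show ?thesis by blast
  qed
  ultimately show "has_big_ramsey_degree S X"
    unfolding has_big_ramsey_degree_def by blast
qed

end
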